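(* Let $\delta$ be a diagonal function, and let $\psi_1,\psi_2:[0,1]\to\mathbb{R}$ be continuous functions with $\psi_1(0)=\psi_2(0)=0$ such that for each $i\in\{1,2\}$ the four functions $\psi_i(x)$, $x-\psi_i(x)$, $\psi_i(x)+x-\delta(x)$ and $\delta(x)-\psi_i(x)$ are increasing on $[0,1]$. Let $C_{\psi_1}$ and $C_{\psi_2}$ be the associated copulas. Then either $C_{\psi_1}=C_{\psi_2}$, or neither of them dominates the other, i.e. neither $C_{\psi_1}\le C_{\psi_2}$ nor $C_{\psi_2}\le C_{\psi_1}$ holds pointwise on $[0,1]^2$.
   Context: "Increasing" means non-decreasing; $a\wedge b=\min\{a,b\}$. A diagonal function is a function $\delta:[0,1]\to[0,1]$ that is increasing, satisfies $\delta(1)=1$, $\delta(t)\le t$ for all $t$, and $|\delta(t')-\delta(t)|\le 2|t'-t|$ for all $t,t'\in[0,1]$. For a function $\psi:[0,1]\to\mathbb{R}$, define for $(x,y)\in[0,1]^2$ $$C_\psi(x,y)=\bigl[\psi(x)\wedge(y-\delta(y)+\psi(y))\bigr]+\bigl[(x-\psi(x))\wedge(\delta(y)-\psi(y))\bigr].$$ Under the stated hypotheses on $\psi_i$, $C_{\psi_i}$ is a (bivariate) copula with $C_{\psi_i}(x,x)=\delta(x)$. A bivariate copula is a function $C:[0,1]^2\to[0,1]$ with $C(x,0)=C(0,x)=0$, $C(x,1)=C(1,x)=x$ and $C(x_2,y_2)-C(x_1,y_2)-C(x_2,y_1)+C(x_1,y_1)\ge0$ whenever $x_1\le x_2$, $y_1\le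 y_2$. *)

theory Defs
  imports "HOL-Analysis.Analysis"
begin

text \<open>Functions on \<open>[0,1]\<close> and \<open>[0,1]\<^sup>2\<close> are represented by total functions on the reals of which
  only the values on the unit interval or the unit square matter.\<close>

definition diagonal_function :: "(real \<Rightarrow> real) \<Rightarrow> bool" where
  "diagonal_function \<delta> \<longleftrightarrow>
     (\<forall>t\<in>{0..1}. \<delta> t \<in> {0..1}) \<and>
     mono_on {0..1} \<delta> \<and>
     \<delta> 1 = 1 \<and>
     (\<forall>t\<in>{0..1}. \<delta> t \<le> t) \<and>
     (\<forall>t\<in>{0..1}. \<forall>t'\<in>{0..1}. \<bar>\<delta> t' - \<delta> t\<bar> \<le> 2 * \<bar>t' - t\<bar>)"

definition bivariate_copula :: "(real \<Rightarrow> real \<Rightarrow> real) \<Rightarrow> bool" where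
  "bivariate_copula C \<longleftrightarrow>
     (\<forall>x\<in>{0..1}. \<forall>y\<in>{0..1}. C x y \<in> {0..1}) \<and>
     (\<forall>x\<in>{0..1}. C x 0 = 0 \<and> C 0 x = 0) \<and>
     (\<forall>x\<in>{0..1}. C x 1 = x \<and> C 1 x = x) \<and>
     (\<forall>x1\<in>{0..1}. \<forall>x2\<in>{0..1}. \<forall>y1\<in>{0..1}. \<forall>y2\<in>{0..1}. x1 \<le> x2 \<longrightarrow> y1 \<le> y2 \<longrightarrow>
        C x2 y2 - C x1 y2 - C x2 y1 + C x1 y1 \<ge> 0)"

definition admissible :: "(real \<Rightarrow> real) \<Rightarrow> (real \<Rightarrow> real) \<Rightarrow> bool" where
  "admissible \<delta> \<psi> \<longleftrightarrow>
     continuous_on {0..1} \<psi> \<and>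
     \<psi> 0 = 0 \<and>
     mono_on {0..1} \<psi> \<and>
     mono_on {0..1} (\<lambda>x. x - \<psi> x) \<and>
     mono_on {0..1} (\<lambda>x. \<psi> x + x - \<delta> x) \<and>
     mono_on {0..1} (\<lambda>x. \<delta> x - \<psi> x)"

definition copula_of :: "(real \<Rightarrow> real) \<Rightarrow> (real \<Rightarrow> real) \<Rightarrow> real \<Rightarrow> real \<Rightarrow> real" where
  "copula_of \<delta> \<psi> x y = min (\<psi> x) (y - \<delta> y + \<psi> y) + min (x - \<psi> x) (\<delta> y - \<psi> y)"

definition pointwise_le :: "(real \<Rightarrow> real \<Rightarrow> real) \<Rightarrow> (real \<Rightarrow> real \<Rightarrow> real) \<Rightarrow> bool" where
  "pointwise_le C D \<longleftrightarrow> (\<forall>x\<in>{0..1}. \<forall>y\<in>{0..1}. C x y \<le> D x y)"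

lemma copula_of_diagonal:
  assumes "diagonal_function \<delta>" "x \<in> {0..1}"
  shows "copula_of \<delta> \<psi> x x = \<delta> x"
proof -
  have "\<delta> x \<le> x" using assms by (simp add: diagonal_function_def)
  then show ?thesis by (simp add: copula_of_def min_def)
qed

lemma min_supermodular:
  fixes a b c d :: real
  assumes "a \<le> b" "c \<le> d"
  shows "min b d - min a d - min b c + min a c \<ge> 0"
  using assms by (auto simp: min_def)

lemma bivariate_copula_copula_of:
  assumes d: "diagonal_function \<delta>" and p: "admissible \<delta> \<psi>"
  shows "bivariate_copula (copula_of \<delta> \<psi>)"
proof -
  let ?C = "copula_of \<delta> \<psi>"
  have m1: "\<psi> s \<le> \<psi> t" and m2: "s - \<psi> s \<le> t - \<psi> t"
    and m3: "s - \<delta> s + \<psi> s \<le> t - \<delta> t + \<psi> t" and m4: "\<delta> s - \<psi> s \<le> \<delta> t - \<psi> t"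
    if "s \<in> {0..1}" "t \<in> {0..1}" "s \<le> t" for s t
    using p that unfolding admissible_def mono_on_def by (auto simp: algebra_simps)
  have d0: "\<delta> 0 = 0" and d1: "\<delta> 1 = 1" and p0: "\<psi> 0 = 0"
    using d p by (force simp: diagonal_function_def admissible_def)+
  have g: "?C x 0 = 0 \<and> ?C 0 x = 0" if "x \<in> {0..1}" for x
    using m1[of 0 x] m2[of 0 x] m3[of 0 x] m4[of 0 x] that d0 p0 by (simp add: copula_of_def min_def)
  have u: "?C x 1 = x \<and> ?C 1 x = x" if "x \<in> {0..1}" for x
    using m1[of x 1] m2[of x 1] m3[of x 1] m4[of x 1] that d1 by (simp add: copula_of_def min_def)
  have v: "?C x2 y2 - ?C x1 y2 - ?C x2 y1 + ?C x1 y1 \<ge> 0"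
    if "x1 \<in> {0..1}" "x2 \<in> {0..1}" "y1 \<in> {0..1}" "y2 \<in> {0..1}" "x1 \<le> x2" "y1 \<le> y2" for x1 x2 y1 y2
    using min_supermodular[OF m1[of x1 x2] m3[of y1 y2]] min_supermodular[OF m2[of x1 x2] m4[of y1 y2]] that
    by (simp add: copula_of_def)
  have "?C x y \<in> {0..1}" if "x \<in> {0..1}" "y \<in> {0..1}" for x y
  proof -
    have "0 \<le> ?C x y" using v[of 0 x 0 y] g[of x] g[of y] g[of 0] that by simp
    moreover have "?C x y \<le> x"
      unfolding copula_of_def by (simp add: min_def)
    ultimately show ?thesis using that by simp
  qed
  then show ?thesis unfolding bivariate_copula_def using g u v by blast
qed

end

theory Submission
  imports Defs
begin

text \<open>The copula is \<open>min x (min y (\<psi> x - \<psi> y + \<delta> y))\<close>. Near a point of the diagonal with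
  \<open>\<delta> t < t\<close> the third term is the smallest, so a pointwise inequality of two copulas, read at
  \<open>(s, t)\<close> and at \<open>(t, s)\<close>, makes the difference of the two generators locally constant there.
  Hence \<open>\<psi> x - \<psi> y\<close> is the same for both whenever no point with \<open>\<delta> t = t\<close> separates \<open>x\<close> and
  \<open>y\<close>; if such a point exists, both copulas take the value \<open>min x y\<close>.\<close>

lemma admissible_increments:
  assumes "admissible \<delta> \<psi>" "s \<in> {0..1}" "t \<in> {0..1}" "s \<le> t"
  shows "\<psi> s \<le> \<psi> t" "s - \<psi> s \<le> t - \<psi> t"
    "s - \<delta> s + \<psi> s \<le> t - \<delta> t + \<psi> t" "\<delta> s - \<psi> s \<le> \<delta> t - \<psi> t"
  using assms unfolding admissible_def mono_on_def by (auto simp: algebra_simps)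

lemma admissible_nonexpansive:
  assumes "admissible \<delta> \<psi>" "s \<in> {0..1}" "t \<in> {0..1}"
  shows "\<bar>\<psi> s - \<psi> t\<bar> \<le> \<bar>s - t\<bar>"
  using admissible_increments(1,2)[OF assms] admissible_increments(1,2)[OF assms(1,3,2)] by linarith

lemma diagonal_functionD:
  assumes "diagonal_function \<delta>" "t \<in> {0..1}"
  shows "\<delta> t \<le> t" "t' \<in> {0..1} \<Longrightarrow> \<bar>\<delta> t' - \<delta> t\<bar> \<le> 2 * \<bar>t' - t\<bar>"
  using assms unfolding diagonal_function_def by blast+

text \<open>The sum of two minima is the minimum of the four cross sums \<open>x\<close>,
  \<open>y\<close>, \<open>\<psi> x - \<psi> y + \<delta> y\<close> and
  \<open>x + y - \<delta> y - (\<psi> x - \<psi> y)\<close>. By monotonicity the last is at least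
  \<open>min x y\<close>, so it drops out.\<close>

lemma copula_of_eq_min:
  assumes d: "diagonal_function \<delta>" and p: "admissible \<delta> \<psi>"
    and x: "x \<in> {0..1}" and y: "y \<in> {0..1}"
  shows "copula_of \<delta> \<psi> x y = min x (min y (\<psi> x - \<psi> y + \<delta> y))"
  using admissible_increments[OF p x y] admissible_increments[OF p y x]
    diagonal_functionD(1)[OF d x] diagonal_functionD(1)[OF d y]
  unfolding copula_of_def by linarith

text \<open>Comparing \<open>x\<close> and \<open>y\<close> with the fixed point \<open>t\<close>
  between them shows that the third term of the minimum is at least \<open>min x y\<close>.\<close>

lemma copula_of_separated:
  assumes d: "diagonal_function \<delta>" and p: "admissible \<delta> \<psi>"
    and x: "x \<in> {0..1}" and y: "y \<in> {0..1}"
    and t: "t \<in> {min x y..max x y}" "\<delta> t = t"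
  shows "copula_of \<delta> \<psi> x y = min x y"
proof -
  have t': "t \<in> {0..1}" using t x y by auto
  show ?thesis
  proof (cases "x \<le> y")
    case True
    then have "x \<le> t" "t \<le> y" using t by auto
    then show ?thesis
      using admissible_increments(2)[OF p x t'] admissible_increments(4)[OF p t' y] t(2)
        copula_of_eq_min[OF d p x y] by linarith
  next
    case False
    then have "y \<le> t" "t \<le> x" using t by auto
    then show ?thesis
      using admissible_increments(3)[OF p y t'] admissible_increments(1)[OF p t' x] t(2)
        copula_of_eq_min[OF d p x y] by linarith
  qed
qed

text \<open>The factor 4 is 1 + 2 + 1: the Lipschitz constants of \<open>\<psi>\<close> and
  \<open>\<delta>\<close>, plus one more \<open>\<bar>s - t\<bar>\<close> to get from
  \<open>t\<close> down to \<open>min s t\<close>. The second equation uses all of it.\<close>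

lemma copula_of_near_diagonal:
  assumes d: "diagonal_function \<delta>" and p: "admissible \<delta> \<psi>"
    and s: "s \<in> {0..1}" and t: "t \<in> {0..1}" and near: "4 * \<bar>s - t\<bar> \<le> t - \<delta> t"
  shows "copula_of \<delta> \<psi> s t = \<psi> s - \<psi> t + \<delta> t" "copula_of \<delta> \<psi> t s = \<psi> t - \<psi> s + \<delta> s"
proof -
  note bounds = admissible_nonexpansive[OF p s t] diagonal_functionD(2)[OF d t s] near
  show "copula_of \<delta> \<psi> s t = \<psi> s - \<psi> t + \<delta> t"
    using bounds copula_of_eq_min[OF d p s t] by (smt (verit))
  show "copula_of \<delta> \<psi> t s = \<psi> t - \<psi> s + \<delta> s"
    using bounds copula_of_eq_min[OF d p t s] by (smt (verit))
qed

text \<open>Applied to the two generators in either order, this rules out domination between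
  distinct copulas.\<close>

lemma pointwise_le_copula_of_imp_eq:
  assumes d: "diagonal_function \<delta>" and p: "admissible \<delta> \<phi>" and q: "admissible \<delta> \<psi>"
    and le: "pointwise_le (copula_of \<delta> \<phi>) (copula_of \<delta> \<psi>)"
    and x: "x \<in> {0..1}" and y: "y \<in> {0..1}"
  shows "copula_of \<delta> \<phi> x y = copula_of \<delta> \<psi> x y"
proof (cases "\<exists>t\<in>{min x y..max x y}. \<delta> t = t")
  case True
  then show ?thesis using copula_of_separated[OF d _ x y] p q by metis
next
  case False
  let ?A = "{min x y..max x y}" and ?f = "\<lambda>t. \<psi> t - \<phi> t"
  have A: "?A \<subseteq> {0..1}" using x y by auto
  have "?f x = ?f y"
  proof (rule connected_local_const[of ?A x y ?f])
    show "\<forall>t\<in>?A. eventually (\<lambda>s. ?f t = ?f s) (at t within ?A)"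
    proof
      fix t assume "t \<in> ?A"
      then have t: "t \<in> {0..1}" and "\<delta> t \<noteq> t" using A False by blast+
      then have pos: "\<delta> t < t" using diagonal_functionD(1)[OF d t] by simp
      have "?f t = ?f s" if "s \<in> ?A" "dist s t < (t - \<delta> t) / 4" for s
      proof -
        have s: "s \<in> {0..1}" using that(1) A by auto
        have near: "4 * \<bar>s - t\<bar> \<le> t - \<delta> t" using that(2) by (simp add: dist_real_def)
        have "copula_of \<delta> \<phi> s t \<le> copula_of \<delta> \<psi> s t" "copula_of \<delta> \<phi> t s \<le> copula_of \<delta> \<psi> t s"
          using le s t unfolding pointwise_le_def by blast+
        \<comment> \<open>Once \<open>\<delta> t\<close> and \<open>\<delta> s\<close> cancel, the
          two inequalities bound \<open>\<psi> s - \<psi> t\<close> from below and from above by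
          \<open>\<phi> s - \<phi> t\<close>.\<close>
        then show ?thesis
          using copula_of_near_diagonal[OF d p s t near] copula_of_near_diagonal[OF d q s t near]
          by linarith
      qed
      then show "eventually (\<lambda>s. ?f t = ?f s) (at t within ?A)"
        unfolding eventually_at using pos by (intro exI[of _ "(t - \<delta> t) / 4"]) auto
    qed
  qed auto
  \<comment> \<open>The minimum formula involves a generator only through this increment.\<close>
  then have "\<phi> x - \<phi> y = \<psi> x - \<psi> y" by linarith
  then show ?thesis by (simp add: copula_of_eq_min[OF d _ x y] p q)
qed

theorem theorem5p6:
  fixes \<delta> \<psi>\<^sub>1 \<psi>\<^sub>2 :: "real \<Rightarrow> real"
  assumes "diagonal_function \<delta>"
    and "admissible \<delta> \<psi>\<^sub>1"
    and "admissible \<delta> \<psi>\<^sub>2"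
  shows "(\<forall>x\<in>{0..1}. \<forall>y\<in>{0..1}. copula_of \<delta> \<psi>\<^sub>1 x y = copula_of \<delta> \<psi>\<^sub>2 x y) \<or>
    (\<not> pointwise_le (copula_of \<delta> \<psi>\<^sub>1) (copula_of \<delta> \<psi>\<^sub>2) \<and>
     \<not> pointwise_le (copula_of \<delta> \<psi>\<^sub>2) (copula_of \<delta> \<psi>\<^sub>1))"
  using pointwise_le_copula_of_imp_eq[OF assms(1)] assms(2,3) by metis

end
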